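(* For any left weak composition $\alpha$, $$M_\alpha=\sum_{\beta\preceq\alpha}(-1)^{\ell(\beta)-\ell(\alpha)}c_{\alpha,\beta}F_\beta.$$
   Context: Coefficients are in $\mathbb{Q}$; $x_1,x_2,\ldots$ are commuting variables; $0^i$ denotes $i$ zero entries; $\ell(\gamma)$ is the number of entries of a sequence $\gamma$. A left weak composition is a finite nonempty sequence of nonnegative integers whose last entry is positive; a composition of $s$ is a nonempty finite sequence of positive integers summing to $s$. For a left weak composition $\gamma=(\gamma_1,\ldots,\gamma_r)$, $M_\gamma=\sum_{1\leq n_1<\cdots<n_r}x_{n_1}^{\gamma_1}\cdots x_{n_r}^{\gamma_r}$. For $\alpha=(0^{i_1},s_1,\ldots,0^{i_k},s_k)$ ($s_p\geq1$): $\beta\preceq\alpha$ iff $\beta$ can be written as $(0^{j_1},\beta_1,\ldots,0^{j_k},\beta_k)$ with $0\leq j_p\leq i_p$ and $\beta_p$ a composition of $s_p$ for all $p$; in that case $c_{\alpha,\beta}=\binom{i_1}{j_1}\cdots\binom{i_k}{j_k}$. With $a_p=i_1+s_1+\cdots+i_p+s_p$ ($a_0=0$), $F_\alpha=\sum x_{n_1}^0\cdots x_{n_{i_1}}^0x_{n_{i_1+1}}\cdots x_{n_{a_1}}\cdots x_{n_{a_{k-1}+1}}^0\cdots x_{n_{a_{k-1}+i_k}}^0x_{n_{a_{k-1}+i_k+1}}\cdots x_{n_{a_k}}$ summed over $1\leq n_1\leq\cdots\leq n_{a_1}<n_{a_1+1}\leq\cdots<n_{a_{k-1}+1}\leq\cdots\leq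 n_{a_k}$ (weak inequalities except strict at positions $a_1,\ldots,a_{k-1}$). *)

theory Defs
  imports Complex_Main "HOL-Library.Poly_Mapping"
begin

text \<open>A monomial in \<open>x\<^sub>1, x\<^sub>2, \<dots>\<close> is a finitely supported exponent vector; a formal power series over
  the rationals is the function sending a monomial to its coefficient. The index 0 is never used,
  since the index sequences below consist of positive integers.\<close>

type_synonym monomial = "nat \<Rightarrow>\<^sub>0 nat"
type_synonym series = "monomial \<Rightarrow> rat"

definition mono_of :: "nat list \<Rightarrow> nat list \<Rightarrow> monomial" where
  "mono_of ns e = (\<Sum>(n, a)\<leftarrow>zip ns e. Poly_Mapping.single n a)"

text \<open>The formal sum of the monomials \<open>mono_of ns e\<close> over all \<open>ns \<in> N\<close>. It makes sense only if every
  monomial arises from finitely many \<open>ns\<close>; see \<open>finite_M\<close> and \<open>finite_F\<close> below.\<close>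

definition series_of :: "nat list set \<Rightarrow> nat list \<Rightarrow> series" where
  "series_of N e = (\<lambda>m. of_nat (card {ns \<in> N. mono_of ns e = m}))"

definition left_weak_comp :: "nat list \<Rightarrow> bool" where
  "left_weak_comp \<gamma> \<longleftrightarrow> \<gamma> \<noteq> [] \<and> last \<gamma> > 0"

definition composition_of :: "nat \<Rightarrow> nat list \<Rightarrow> bool" where
  "composition_of s b \<longleftrightarrow> b \<noteq> [] \<and> (\<forall>x\<in>set b. x > 0) \<and> sum_list b = s"

definition M_indices :: "nat list \<Rightarrow> nat list set" where
  "M_indices \<gamma> = {ns. length ns = length \<gamma> \<and> (\<forall>n\<in>set ns. 1 \<le> n) \<and> sorted_wrt (<) ns}"

definition M_series :: "nat list \<Rightarrow> series" where
  "M_series \<gamma> = series_of (M_indices \<gamma>) \<gamma>"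

text \<open>\<open>blocks \<alpha> = [(i\<^sub>1, s\<^sub>1), \<dots>, (i\<^sub>k, s\<^sub>k)]\<close> for \<open>\<alpha> = (0\<^sup>i\<^sup>1, s\<^sub>1, \<dots>, 0\<^sup>i\<^sup>k, s\<^sub>k)\<close>; the first argument of
  \<open>blocks_from\<close> counts the zeros read since the last positive entry. See \<open>blocks_iff\<close>.\<close>

fun blocks_from :: "nat \<Rightarrow> nat list \<Rightarrow> (nat \<times> nat) list" where
  "blocks_from i [] = []"
| "blocks_from i (a # as) = (if a = 0 then blocks_from (Suc i) as else (i, a) # blocks_from 0 as)"

definition blocks :: "nat list \<Rightarrow> (nat \<times> nat) list" where
  "blocks \<alpha> = blocks_from 0 \<alpha>"

text \<open>\<open>decomp \<alpha> w \<beta>\<close>, where \<open>w = [(j\<^sub>1, \<beta>\<^sub>1), \<dots>, (j\<^sub>k, \<beta>\<^sub>k)]\<close>, says that \<open>\<beta> = (0\<^sup>j\<^sup>1, \<beta>\<^sub>1, \<dots>, 0\<^sup>j\<^sup>k, \<beta>\<^sub>k)\<close> is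
  a decomposition witnessing \<open>\<beta> \<preceq> \<alpha>\<close>.\<close>

definition decomp :: "nat list \<Rightarrow> (nat \<times> nat list) list \<Rightarrow> nat list \<Rightarrow> bool" where
  "decomp \<alpha> w \<beta> \<longleftrightarrow>
     list_all2 (\<lambda>(i, s) (j, b). j \<le> i \<and> composition_of s b) (blocks \<alpha>) w \<and>
     \<beta> = concat (map (\<lambda>(j, b). replicate j 0 @ b) w)"

definition preceq :: "nat list \<Rightarrow> nat list \<Rightarrow> bool"  (infix "\<preceq>" 50) where
  "\<beta> \<preceq> \<alpha> \<longleftrightarrow> (\<exists>w. decomp \<alpha> w \<beta>)"

text \<open>The decomposition is unique, see \<open>decomp_unique\<close>.\<close>

definition c_coeff :: "nat list \<Rightarrow> nat list \<Rightarrow> nat" where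
  "c_coeff \<alpha> \<beta> = (\<Prod>((i, s), (j, b))\<leftarrow>zip (blocks \<alpha>) (THE w. decomp \<alpha> w \<beta>). i choose j)"

text \<open>The exponents \<open>(0\<^sup>i\<^sup>1, 1\<^sup>s\<^sup>1, \<dots>, 0\<^sup>i\<^sup>k, 1\<^sup>s\<^sup>k)\<close> of the monomials in \<open>F_series \<alpha>\<close>.\<close>

definition F_exponents :: "nat list \<Rightarrow> nat list" where
  "F_exponents \<alpha> = concat (map (\<lambda>(i, s). replicate i 0 @ replicate s 1) (blocks \<alpha>))"

text \<open>\<open>a_pos \<alpha> p = a\<^sub>p = i\<^sub>1 + s\<^sub>1 + \<dots> + i\<^sub>p + s\<^sub>p\<close>\<close>

definition a_pos :: "nat list \<Rightarrow> nat \<Rightarrow> nat" where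
  "a_pos \<alpha> p = (\<Sum>(i, s)\<leftarrow>take p (blocks \<alpha>). i + s)"

text \<open>As lists are indexed from 0, \<open>ns ! (j - 1)\<close> and \<open>ns ! j\<close> are the indices \<open>n\<^sub>j\<close> and \<open>n\<^bsub>j+1\<^esub>\<close>.\<close>

definition F_indices :: "nat list \<Rightarrow> nat list set" where
  "F_indices \<alpha> = {ns. length ns = a_pos \<alpha> (length (blocks \<alpha>)) \<and> (\<forall>n\<in>set ns. 1 \<le> n) \<and>
     (\<forall>j. 1 \<le> j \<and> j < length ns \<longrightarrow>
        (if j \<in> a_pos \<alpha> ` {1..<length (blocks \<alpha>)} then ns ! (j - 1) < ns ! j
         else ns ! (j - 1) \<le> ns ! j))}"

definition F_series :: "nat list \<Rightarrow> series" where
  "F_series \<alpha> = series_of (F_indices \<alpha>) (F_exponents \<alpha>)"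


subsection \<open>Well-definedness\<close>

lemma blocks_from_concat:
  "as \<noteq> [] \<Longrightarrow> last as > 0 \<Longrightarrow>
   concat (map (\<lambda>(i, s). replicate i 0 @ [s]) (blocks_from i as)) = replicate i 0 @ as"
proof (induction as arbitrary: i)
  case (Cons a as)
  have shift: "replicate i 0 @ (0::nat) # bs = 0 # replicate i 0 @ bs" for bs
    by (induction i) auto
  show ?case
  proof (cases "as = []")
    case True then show ?thesis using Cons.prems by simp
  next
    case False
    then show ?thesis using Cons.prems Cons.IH[of 0] Cons.IH[of "Suc i"] by (simp add: shift)
  qed
qed simp

lemma blocks_from_replicate:
  "blocks_from i (replicate k 0 @ as) = blocks_from (i + k) as"
  by (induction k arbitrary: i) auto

lemma blocks_from_pos: "(i, s) \<in> set (blocks_from k as) \<Longrightarrow> s > 0"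
  by (induction as arbitrary: k) (auto split: if_splits)

lemma blocks_of_concat:
  "(\<forall>(i, s)\<in>set ps. s > 0) \<Longrightarrow>
   blocks (concat (map (\<lambda>(i, s). replicate i 0 @ [s]) ps)) = ps"
  by (induction ps) (auto simp: blocks_def blocks_from_replicate)

lemma blocks_iff:
  assumes "left_weak_comp \<alpha>"
  shows "blocks \<alpha> = ps \<longleftrightarrow>
     (\<forall>(i, s)\<in>set ps. s > 0) \<and> \<alpha> = concat (map (\<lambda>(i, s). replicate i 0 @ [s]) ps)"
  using assms blocks_from_concat[of \<alpha> 0] blocks_from_pos[of _ _ 0 \<alpha>] blocks_of_concat[of ps]
  by (auto simp: left_weak_comp_def blocks_def)

lemma blocks_nonempty: "left_weak_comp \<alpha> \<Longrightarrow> blocks \<alpha> \<noteq> []"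
  using blocks_iff[of \<alpha> "[]"] by (auto simp: left_weak_comp_def)

lemma replicate_zero_cancel:
  fixes b b' :: "nat list"
  assumes "replicate j 0 @ b = replicate j' 0 @ b'"
    and "b \<noteq> []" "hd b > 0" "b' \<noteq> []" "hd b' > 0"
  shows "j = j' \<and> b = b'"
  using assms
proof (induction j arbitrary: j')
  case 0 then show ?case by (cases j') auto
next
  case (Suc j) then show ?case by (cases j') auto
qed

lemma append_sum_cancel:
  fixes b b' :: "nat list"
  assumes "b @ r = b' @ r'" "sum_list b = sum_list b'"
    and "\<forall>x\<in>set b. x > 0" "\<forall>x\<in>set b'. x > 0"
  shows "b = b' \<and> r = r'"
  using assms
proof (induction b arbitrary: b')
  case Nil then show ?case by (cases b') auto
next
  case (Cons x b) then show ?case by (cases b') auto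
qed

lemma decomp_unique:
  assumes "decomp \<alpha> w \<beta>" "decomp \<alpha> w' \<beta>"
  shows "w = w'"
proof -
  let ?R = "\<lambda>(i, s) (j, b). j \<le> i \<and> composition_of s b"
  let ?cat = "\<lambda>w. concat (map (\<lambda>(j, b). replicate j 0 @ b) w) :: nat list"
  have "list_all2 ?R bs w \<Longrightarrow> list_all2 ?R bs w' \<Longrightarrow> ?cat w = ?cat w' \<Longrightarrow> w = w'" for bs
  proof (induction bs arbitrary: w w')
    case Nil then show ?case by simp
  next
    case (Cons p bs)
    obtain i s where p: "p = (i, s)" by force
    obtain j b u where w: "w = (j, b) # u" "composition_of s b" "list_all2 ?R bs u"
      using Cons.prems(1) by (auto simp: p list_all2_Cons1)
    obtain j' b' u' where w': "w' = (j', b') # u'" "composition_of s b'" "list_all2 ?R bs u'"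
      using Cons.prems(2) by (auto simp: p list_all2_Cons1)
    have "replicate j 0 @ (b @ ?cat u) = replicate j' 0 @ (b' @ ?cat u')"
      using Cons.prems(3) w w' by simp
    then have *: "j = j' \<and> b @ ?cat u = b' @ ?cat u'"
      by (rule replicate_zero_cancel) (use w w' in \<open>auto simp: composition_of_def\<close>)
    then have "b = b' \<and> ?cat u = ?cat u'"
      using append_sum_cancel[of b "?cat u" b' "?cat u'"] w w' by (auto simp: composition_of_def)
    then show ?case using * w w' Cons.IH[of u u'] by simp
  qed
  then show ?thesis using assms unfolding decomp_def by blast
qed

lemma c_coeff_eq:
  assumes "decomp \<alpha> w \<beta>"
  shows "c_coeff \<alpha> \<beta> = (\<Prod>((i, s), (j, b))\<leftarrow>zip (blocks \<alpha>) w. i choose j)"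
proof -
  have "(THE w. decomp \<alpha> w \<beta>) = w"
    using assms decomp_unique by blast
  then show ?thesis by (simp add: c_coeff_def)
qed

lemma composition_length: "composition_of s b \<Longrightarrow> length b \<le> s"
proof -
  have "(\<forall>x\<in>set b. x > 0) \<Longrightarrow> length b \<le> sum_list b" by (induction b) auto
  then show "composition_of s b \<Longrightarrow> length b \<le> s" by (auto simp: composition_of_def)
qed

lemma finite_composition_of: "finite {b. composition_of s b}"
proof (rule finite_subset)
  show "{b. composition_of s b} \<subseteq> {b. set b \<subseteq> {..s} \<and> length b \<le> s}"
    using composition_length by (auto simp: composition_of_def dest: member_le_sum_list)
  show "finite {b. set b \<subseteq> {..s} \<and> length b \<le> s}"
    by (rule finite_lists_length_le) simp
qed

lemma finite_list_all2:
  "\<forall>x\<in>set xs. finite {y. R x y} \<Longrightarrow> finite {ys. list_all2 R xs ys}"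
proof (induction xs)
  case Nil
  have "{ys. list_all2 R [] ys} = {[]}" by auto
  then show ?case by simp
next
  case (Cons x xs)
  have "{ys. list_all2 R (x # xs) ys} = case_prod Cons ` ({y. R x y} \<times> {ys. list_all2 R xs ys})"
    by (auto simp: list_all2_Cons1 image_iff)
  then show ?case using Cons by simp
qed

lemma finite_preceq: "finite {\<beta>. \<beta> \<preceq> \<alpha>}"
proof -
  let ?R = "\<lambda>(i, s) (j, b). j \<le> i \<and> composition_of s b"
  have "finite {y. ?R x y}" for x :: "nat \<times> nat"
  proof (cases x)
    case (Pair i s)
    have "{y. ?R x y} = {..i} \<times> {b. composition_of s b}" by (auto simp: Pair)
    then show ?thesis using finite_composition_of by simp
  qed
  then have "finite {w. list_all2 ?R (blocks \<alpha>) w}" by (intro finite_list_all2) blast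
  moreover have "{\<beta>. \<beta> \<preceq> \<alpha>} \<subseteq>
      (\<lambda>w. concat (map (\<lambda>(j, b). replicate j 0 @ b) w)) ` {w. list_all2 ?R (blocks \<alpha>) w}"
    by (auto simp: preceq_def decomp_def)
  ultimately show ?thesis using finite_surj by blast
qed

lemma concat_last_pos:
  "w \<noteq> [] \<Longrightarrow> (\<forall>x\<in>set w. f x \<noteq> [] \<and> last (f x) > (0::nat)) \<Longrightarrow>
   concat (map f w) \<noteq> [] \<and> last (concat (map f w)) > 0"
  by (induction w rule: rev_induct) auto

lemma preceq_left_weak_comp:
  assumes "left_weak_comp \<alpha>" "\<beta> \<preceq> \<alpha>"
  shows "left_weak_comp \<beta>"
proof -
  obtain w where w: "decomp \<alpha> w \<beta>" using assms(2) by (auto simp: preceq_def)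
  have "w \<noteq> []" using w blocks_nonempty[OF assms(1)] by (auto simp: decomp_def)
  moreover have "snd x \<noteq> [] \<and> last (snd x) > 0" if x: "x \<in> set w" for x
  proof -
    obtain q where "q < length w" "w ! q = x" using x by (auto simp: in_set_conv_nth)
    then have "composition_of (snd (blocks \<alpha> ! q)) (snd x)"
      using w by (auto simp: decomp_def list_all2_conv_all_nth case_prod_unfold)
    then show ?thesis by (auto simp: composition_of_def)
  qed
  ultimately show ?thesis
    using concat_last_pos[of w "\<lambda>(j, b). replicate j 0 @ b"] w
    by (fastforce simp: decomp_def left_weak_comp_def)
qed

lemma finite_fibre:
  assumes e: "e \<noteq> []" "last e > 0"
    and N: "\<And>ns. ns \<in> N \<Longrightarrow> length ns = length e \<and> sorted ns"
  shows "finite {ns \<in> N. mono_of ns e = m}"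
proof (rule finite_subset)
  let ?K = "Poly_Mapping.keys m"
  show "finite {ns. set ns \<subseteq> {..Max ?K} \<and> length ns = length e}"
    by (rule finite_lists_length_eq) simp
  show "{ns \<in> N. mono_of ns e = m} \<subseteq> {ns. set ns \<subseteq> {..Max ?K} \<and> length ns = length e}"
  proof clarify
    fix ns assume ns: "ns \<in> N" "m = mono_of ns e"
    have len: "length ns = length e" and srt: "sorted ns" using N ns by auto
    obtain e' x where e': "e = e' @ [x]" "x > 0" using e by (cases e rule: rev_cases) auto
    obtain ns' y where ns': "ns = ns' @ [y]" "length ns' = length e'"
      using len e' by (cases ns rule: rev_cases) auto
    have "mono_of ns e = mono_of ns' e' + Poly_Mapping.single y x"
      by (simp add: mono_of_def e' ns')
    then have "Poly_Mapping.lookup m y > 0"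
      using e' ns by (simp add: lookup_add)
    then have "y \<in> Poly_Mapping.keys m" by (simp add: in_keys_iff)
    then have "y \<le> Max ?K" by simp
    then have "\<forall>z\<in>set ns. z \<le> Max ?K" using srt by (auto simp: ns' sorted_append)
    then show "set ns \<subseteq> {..Max (Poly_Mapping.keys (mono_of ns e))} \<and> length ns = length e"
      using len ns by auto
  qed
qed

lemma finite_M:
  assumes "left_weak_comp \<gamma>"
  shows "finite {ns \<in> M_indices \<gamma>. mono_of ns \<gamma> = m}"
  by (rule finite_fibre)
     (use assms in \<open>auto simp: left_weak_comp_def M_indices_def strict_sorted_imp_sorted\<close>)

lemma length_F_exponents: "length (F_exponents \<alpha>) = a_pos \<alpha> (length (blocks \<alpha>))"
  by (simp add: F_exponents_def a_pos_def length_concat comp_def case_prod_unfold)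

lemma finite_F:
  assumes "left_weak_comp \<alpha>"
  shows "finite {ns \<in> F_indices \<alpha>. mono_of ns (F_exponents \<alpha>) = m}"
proof (rule finite_fibre)
  have "F_exponents \<alpha> \<noteq> [] \<and> last (F_exponents \<alpha>) > 0"
    unfolding F_exponents_def using blocks_nonempty[OF assms]
    by (rule concat_last_pos) (auto simp: blocks_def dest: blocks_from_pos)
  then show "F_exponents \<alpha> \<noteq> []" "last (F_exponents \<alpha>) > 0" by auto
  fix ns assume ns: "ns \<in> F_indices \<alpha>"
  have "ns ! i \<le> ns ! Suc i" if i: "Suc i < length ns" for i
  proof -
    have "if Suc i \<in> a_pos \<alpha> ` {1..<length (blocks \<alpha>)} then ns ! (Suc i - 1) < ns ! Suc i
          else ns ! (Suc i - 1) \<le> ns ! Suc i"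
      using ns i unfolding F_indices_def mem_Collect_eq
      by (elim conjE, elim allE[of _ "Suc i"], elim impE) simp_all
    then show ?thesis
      by (cases "Suc i \<in> a_pos \<alpha> ` {1..<length (blocks \<alpha>)}")
         (simp_all add: less_imp_le)
  qed
  then show "length ns = length (F_exponents \<alpha>) \<and> sorted ns"
    using ns by (auto simp: length_F_exponents F_indices_def sorted_iff_nth_Suc)
qed

end

theory Submission
  imports Defs
begin

text \<open>Both kinds of series are iterated sums over increasing index sequences, so after truncating to
  indices at most \<open>B\<close> (harmless for the coefficient of a fixed monomial) they are obtained by applying
  linear operators to the constant function 1: let \<open>(S g)(t)\<close> be the sum of \<open>g(n)\<close> over \<open>t < n \<le> B\<close>, let
  \<open>W = S + 1\<close> be its weak variant, and let \<open>D\<close> multiply by \<open>x\<^sub>n\<close>. A block \<open>(0\<^sup>i, s)\<close> contributes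
  \<open>S S\<^sup>i D\<^sup>s\<close> to \<open>M\<close>, and a block \<open>(0\<^sup>j, s)\<close> contributes \<open>S W\<^sup>j D (W D)\<^bsup>s-1\<^esup>\<close> to \<open>F\<close>. As \<open>W - S = 1\<close>,
  the signed sum over the compositions of \<open>s\<close> expands \<open>D ((W - S) D)\<^bsup>s-1\<^esup> = D\<^sup>s\<close>, and the sum over \<open>j\<close>
  is the binomial expansion of \<open>(W - 1)\<^sup>i = S\<^sup>i\<close>.\<close>

section \<open>Index sequences with strict and weak steps\<close>

text \<open>One flag per step records whether it is strict, so that the index sequences of both
  kinds of series are chains. With \<open>t = 0\<close> and a strict first step, the indices are
  positive.\<close>

fun chains :: "nat \<Rightarrow> nat \<Rightarrow> bool list \<Rightarrow> nat list set" where
  "chains B t [] = {[]}"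
| "chains B t (w # ws) = (\<Union>n\<in>{(if w then Suc t else t)..B}. (#) n ` chains B n ws)"

lemma finite_chains: "finite (chains B t ws)"
  by (induction B t ws rule: chains.induct) auto

lemma in_chains_iff:
  "ns \<in> chains B t ws \<longleftrightarrow> length ns = length ws \<and> (\<forall>n\<in>set ns. n \<le> B) \<and>
     (\<forall>j<length ns. if ws ! j then (t # ns) ! j < ns ! j else (t # ns) ! j \<le> ns ! j)"
proof (induction ws arbitrary: t ns)
  case Nil
  then show ?case by auto
next
  case (Cons w ws)
  show ?case
  proof (cases ns)
    case Nil
    then show ?thesis by auto
  next
    case (Cons n ns')
    have "ns \<in> chains B t (w # ws) \<longleftrightarrow>
        (if w then t < n else t \<le> n) \<and> n \<le> B \<and> ns' \<in> chains B n ws"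
      by (auto simp: Cons Suc_le_eq)
    then show ?thesis
      unfolding Cons.IH by (auto simp: Cons All_less_Suc2)
  qed
qed

section \<open>Sums over chains as iterated linear operators\<close>

context
  fixes B :: nat and x :: "nat \<Rightarrow> 'a::comm_ring_1"
begin

definition strict_sum :: "(nat \<Rightarrow> 'a) \<Rightarrow> nat \<Rightarrow> 'a" where
  "strict_sum g t = (\<Sum>n\<in>{t<..B}. g n)"

definition weak_sum :: "(nat \<Rightarrow> 'a) \<Rightarrow> nat \<Rightarrow> 'a" where
  "weak_sum g t = g t + strict_sum g t"

definition xmult :: "(nat \<Rightarrow> 'a) \<Rightarrow> nat \<Rightarrow> 'a" where
  "xmult g n = x n * g n"

definition step :: "bool \<Rightarrow> nat \<Rightarrow> (nat \<Rightarrow> 'a) \<Rightarrow> nat \<Rightarrow> 'a" where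
  "step w a g = (if w then strict_sum else weak_sum) ((xmult ^^ a) g)"

definition eval_mono :: "nat list \<Rightarrow> nat list \<Rightarrow> 'a" where
  "eval_mono ns e = (\<Prod>(n, a)\<leftarrow>zip ns e. x n ^ a)"

lemma xmult_funpow: "(xmult ^^ a) g n = x n ^ a * g n"
  by (induction a) (simp_all add: xmult_def mult.assoc)

text \<open>The bound on \<open>t\<close> matters because \<open>weak_sum\<close> includes the term
  at \<open>t\<close> even beyond the truncation, where the interval is empty.\<close>

lemma step_eq:
  assumes "t \<le> B"
  shows "step w a g t = (\<Sum>n\<in>{(if w then Suc t else t)..B}. x n ^ a * g n)"
proof -
  have "{t..B} = insert t {Suc t..B}" "{t<..B} = {Suc t..B}" using assms by auto
  then show ?thesis
    by (simp add: step_def weak_sum_def strict_sum_def xmult_funpow)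
qed

text \<open>The first index \<open>n\<close> of a chain is the lower bound for its tail. Summing
  over the tails first therefore leaves a function of \<open>n\<close>, to which the outermost
  \<open>step\<close> applies.\<close>

lemma sum_chains:
  assumes "length ws = length e" "t \<le> B"
  shows "(\<Sum>ns\<in>chains B t ws. eval_mono ns e) =
    foldr (\<lambda>(w, a). step w a) (zip ws e) (\<lambda>_. 1) t"
  using assms
proof (induction ws e arbitrary: t rule: list_induct2)
  case Nil
  then show ?case by (simp add: eval_mono_def)
next
  case (Cons w ws a e)
  let ?I = "{(if w then Suc t else t)..B}"
  have "(\<Sum>ns\<in>chains B t (w # ws). eval_mono ns (a # e)) =
      (\<Sum>n\<in>?I. \<Sum>ns\<in>(#) n ` chains B n ws. eval_mono ns (a # e))"
    unfolding chains.simps by (rule sum.UNION_disjoint) (auto simp: finite_chains)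
  also have "\<dots> = (\<Sum>n\<in>?I. x n ^ a * (\<Sum>ns\<in>chains B n ws. eval_mono ns e))"
    by (rule sum.cong) (auto simp: sum.reindex eval_mono_def sum_distrib_left)
  also have "\<dots> = (\<Sum>n\<in>?I. x n ^ a * foldr (\<lambda>(w, a). step w a) (zip ws e) (\<lambda>_. 1) n)"
    by (rule sum.cong) (auto simp: Cons.IH)
  finally show ?case using Cons.prems by (simp add: step_eq)
qed

definition lin :: "((nat \<Rightarrow> 'a) \<Rightarrow> nat \<Rightarrow> 'a) \<Rightarrow> bool" where
  "lin T \<longleftrightarrow> (\<forall>f g. T (\<lambda>t. f t + g t) = (\<lambda>t. T f t + T g t)) \<and>
     (\<forall>c f. T (\<lambda>t. c * f t) = (\<lambda>t. c * T f t))"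

lemma lin_strict_sum: "lin strict_sum"
  by (auto simp: lin_def strict_sum_def sum.distrib sum_distrib_left)

lemma lin_weak_sum: "lin weak_sum"
  by (auto simp: lin_def weak_sum_def strict_sum_def sum.distrib sum_distrib_left algebra_simps)

lemma lin_xmult: "lin xmult"
  by (auto simp: lin_def xmult_def algebra_simps)

lemma lin_comp: "lin T \<Longrightarrow> lin U \<Longrightarrow> lin (T \<circ> U)"
  by (simp add: lin_def)

lemma lin_funpow: "lin T \<Longrightarrow> lin (T ^^ n)"
  by (induction n) (simp_all add: lin_def)

lemma lin_foldr: "(\<And>y. lin (T y)) \<Longrightarrow> lin (foldr T ys)"
  by (induction ys) (simp_all add: lin_def)

lemma lin_add: "lin T \<Longrightarrow> T (\<lambda>t. f t + g t) t = T f t + T g t"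
  by (simp add: lin_def)

lemma lin_scale: "lin T \<Longrightarrow> T (\<lambda>t. c * f t) t = c * T f t"
  by (simp add: lin_def)

lemma lin_sum:
  assumes "lin T"
  shows "T (\<lambda>t. \<Sum>i\<in>I. c i * f i t) t = (\<Sum>i\<in>I. c i * T (f i) t)"
proof -
  \<comment> \<open>Covers the empty set and also an infinite \<open>I\<close>, for which both sums
    are 0 by convention.\<close>
  have "T (\<lambda>_. 0) t = 0"
    using lin_scale[OF assms, of 0 "\<lambda>_. 0"] by simp
  moreover have "T (\<lambda>t. c i * f i t + h t) t = c i * T (f i) t + T h t" for i h
    by (simp add: lin_add[OF assms] lin_scale[OF assms])
  ultimately show ?thesis
    by (induction I rule: infinite_finite_induct) simp_all
qed

text \<open>The expansion of (W - 1)^i, by induction with Pascal's rule. The sign (-1)^(i - j) is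
  written with a sum in the exponent to avoid truncated subtraction.\<close>

lemma binomial_weak_sum:
  "(\<Sum>j\<le>i. (-1) ^ (i + j) * of_nat (i choose j) * (weak_sum ^^ j) g t) = (strict_sum ^^ i) g t"
proof (induction i arbitrary: g t)
  case 0
  then show ?case by simp
next
  case (Suc i)
  define c where "c = (\<lambda>i j. (-1) ^ (i + j) * of_nat (i choose j) :: 'a)"
  have pascal: "c (Suc i) (Suc j) = c i j - c i (Suc j)" for j
    by (simp add: c_def algebra_simps)
  \<comment> \<open>The coefficient just past the end vanishes, so that the shifted sum can be
    completed to one over the same range as the unshifted sum.\<close>
  have c0: "c (Suc i) 0 = - c i 0" and cn: "c i (Suc i) = 0"
    by (simp_all add: c_def binomial_eq_0)
  have "(\<Sum>j\<le>Suc i. c (Suc i) j * (weak_sum ^^ j) g t) =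
      c (Suc i) 0 * g t + (\<Sum>j\<le>i. c (Suc i) (Suc j) * (weak_sum ^^ Suc j) g t)"
    by (subst sum.atMost_Suc_shift) simp
  also have "\<dots> = (\<Sum>j\<le>i. c i j * (weak_sum ^^ Suc j) g t) -
      (c i 0 * (weak_sum ^^ 0) g t + (\<Sum>j\<le>i. c i (Suc j) * (weak_sum ^^ Suc j) g t))"
    unfolding pascal c0 by (simp add: algebra_simps sum_subtractf del: funpow.simps(2))
  also have "c i 0 * (weak_sum ^^ 0) g t + (\<Sum>j\<le>i. c i (Suc j) * (weak_sum ^^ Suc j) g t) =
      (\<Sum>j\<le>Suc i. c i j * (weak_sum ^^ j) g t)"
    by (subst sum.atMost_Suc_shift) simp
  also have "\<dots> = (\<Sum>j\<le>i. c i j * (weak_sum ^^ j) g t)"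
    by (simp add: cn)
  \<comment> \<open>Termwise, W^(j+1) - W^j = S W^j; linearity then moves the common S to the
    front.\<close>
  also have "(\<Sum>j\<le>i. c i j * (weak_sum ^^ Suc j) g t) - \<dots> =
      (\<Sum>j\<le>i. c i j * strict_sum ((weak_sum ^^ j) g) t)"
    by (simp add: weak_sum_def algebra_simps flip: sum_subtractf)
  also have "\<dots> = strict_sum (\<lambda>t. \<Sum>j\<le>i. c i j * (weak_sum ^^ j) g t) t"
    by (simp add: lin_sum[OF lin_strict_sum])
  also have "\<dots> = (strict_sum ^^ Suc i) g t"
    using Suc.IH unfolding c_def by simp
  finally show ?case by (simp add: c_def)
qed

section \<open>Block operators and signed sums over compositions\<close>

definition run :: "nat \<Rightarrow> (nat \<Rightarrow> 'a) \<Rightarrow> nat \<Rightarrow> 'a" where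
  "run s = xmult \<circ> (weak_sum \<circ> xmult) ^^ (s - 1)"

definition F_block :: "nat \<times> nat \<Rightarrow> (nat \<Rightarrow> 'a) \<Rightarrow> nat \<Rightarrow> 'a" where
  "F_block = (\<lambda>(j, s). strict_sum \<circ> weak_sum ^^ j \<circ> run s)"

definition M_block :: "nat \<times> nat \<Rightarrow> (nat \<Rightarrow> 'a) \<Rightarrow> nat \<Rightarrow> 'a" where
  "M_block = (\<lambda>(i, s). strict_sum \<circ> strict_sum ^^ i \<circ> xmult ^^ s)"

text \<open>The operator of \<open>(0\<^sup>j, b)\<close> with its common prefix \<open>S W\<^sup>j\<close> removed; see \<open>foldr_refine\<close>.\<close>

definition runs :: "nat list \<Rightarrow> (nat \<Rightarrow> 'a) \<Rightarrow> nat \<Rightarrow> 'a" where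
  "runs b g = run (hd b) (foldr (\<lambda>c. F_block (0, c)) (tl b) g)"

lemma lin_run: "lin (run s)"
  unfolding run_def by (intro lin_comp lin_funpow lin_xmult lin_weak_sum)

lemma lin_F_block: "lin (F_block p)"
  unfolding F_block_def
  by (cases p) (auto intro!: lin_comp lin_strict_sum lin_funpow lin_weak_sum lin_run)

text \<open>A prepended part 1 makes the old first part start a new block, which brings in S. In
  \<open>runs_Suc_hd\<close> the first run merely gets longer, which brings in W.\<close>

lemma runs_Cons_1: "b \<noteq> [] \<Longrightarrow> runs (1 # b) g = xmult (strict_sum (runs b g))"
  by (cases b) (simp_all add: runs_def run_def F_block_def)

lemma runs_Suc_hd:
  "c > 0 \<Longrightarrow> runs (Suc c # b) g = xmult (weak_sum (runs (c # b) g))"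
  by (cases c) (simp_all add: runs_def run_def)

text \<open>The two images correspond to a first part equal to 1 or larger. At \<open>s = 0\<close>
  the right-hand side would be empty, although \<open>[1]\<close> is a composition of 1.\<close>

lemma compositions_Suc:
  assumes "s > 0"
  shows "{b. composition_of (Suc s) b} =
    (#) 1 ` {b. composition_of s b} \<union> (\<lambda>b. Suc (hd b) # tl b) ` {b. composition_of s b}"
    (is "?L = ?R")
proof (rule set_eqI)
  fix b
  show "b \<in> ?L \<longleftrightarrow> b \<in> ?R"
  proof (cases b)
    case Nil
    then show ?thesis by (auto simp: composition_of_def)
  next
    case (Cons c cs)
    show ?thesis
    proof
      assume L: "b \<in> ?L"
      show "b \<in> ?R"
      proof (cases "c = 1")
        case True
        then have "composition_of s cs" using L assms by (auto simp: composition_of_def Cons)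
        then show ?thesis using True Cons by auto
      next
        case False
        then obtain d where d: "c = Suc d" "d > 0"
          using L by (cases c) (auto simp: composition_of_def Cons)
        then have "composition_of s (d # cs)" using L by (auto simp: composition_of_def Cons)
        then have "b \<in> (\<lambda>b. Suc (hd b) # tl b) ` {b. composition_of s b}"
          by (intro image_eqI[of _ _ "d # cs"]) (auto simp: Cons d)
        then show ?thesis by simp
      qed
    next
      assume "b \<in> ?R"
      then show "b \<in> ?L"
        by (auto simp: composition_of_def neq_Nil_conv)
    qed
  qed
qed

text \<open>Each composition of \<open>s\<close> yields two of \<open>s + 1\<close>, by a new part 1
  or by a larger first part; together they contribute one further factor D. The sign is normalised
  to be positive for a single part.\<close>

lemma composition_sum:
  assumes "s > 0"
  shows "(\<Sum>b | composition_of s b. (-1) ^ Suc (length b) * runs b g t) = (xmult ^^ s) g t"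
  using assms
proof (induction s arbitrary: t rule: nat_induct_non_zero)
  case 1
  have "b = [1]" if "composition_of 1 b" for b
  proof (cases b)
    case (Cons c cs)
    then show ?thesis using that by (cases cs) (auto simp: composition_of_def)
  qed (use that in \<open>simp add: composition_of_def\<close>)
  then have "{b. composition_of 1 b} = {[1]}" by (auto simp: composition_of_def)
  then show ?case by (simp add: runs_def run_def)
next
  case (Suc s)
  let ?C = "{b. composition_of s b}"
  let ?up = "\<lambda>b. Suc (hd b) # tl b"
  let ?f = "\<lambda>b. (-1) ^ Suc (length b) * runs b g t"
  have ne: "b \<noteq> []" "hd b > 0" if "b \<in> ?C" for b
    using that by (auto simp: composition_of_def)
  have "inj_on ?up ?C"
    by (rule inj_onI) (metis ne(1) list.collapse list.inject nat.inject)
  \<comment> \<open>The first part is 1 on one side and at least 2 on the other.\<close>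
  moreover have "(#) 1 ` ?C \<inter> ?up ` ?C = {}"
    using ne by fastforce
  ultimately have "(\<Sum>b | composition_of (Suc s) b. ?f b) =
      (\<Sum>b\<in>?C. ?f (1 # b)) + (\<Sum>b\<in>?C. ?f (?up b))"
    unfolding compositions_Suc[OF \<open>s > 0\<close>]
    by (subst sum.union_disjoint) (simp_all add: finite_composition_of sum.reindex)
  also have "\<dots> = (\<Sum>b\<in>?C. ?f (1 # b) + ?f (?up b))"
    by (simp add: sum.distrib)
  \<comment> \<open>The two compositions obtained from \<open>b\<close> differ in length by one, so
    their signs are opposite and D W - D S = D remains.\<close>
  also have "\<dots> = (\<Sum>b\<in>?C. (-1) ^ Suc (length b) * xmult (runs b g) t)"
  proof (rule sum.cong)
    fix b assume b: "b \<in> ?C"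
    have "runs (?up b) g = xmult (weak_sum (runs b g))"
      using runs_Suc_hd[of "hd b" "tl b" g] ne[OF b] by simp
    then show "?f (1 # b) + ?f (?up b) = (-1) ^ Suc (length b) * xmult (runs b g) t"
      using ne[OF b] runs_Cons_1[of b g]
      by (simp add: xmult_def weak_sum_def algebra_simps)
  qed simp
  also have "\<dots> = xmult (\<lambda>t. \<Sum>b\<in>?C. (-1) ^ Suc (length b) * runs b g t) t"
    by (rule lin_sum[OF lin_xmult, symmetric])
  also have "\<dots> = (xmult ^^ Suc s) g t"
    by (simp only: Suc.IH) simp
  finally show ?case .
qed

text \<open>The blocks of \<open>(0\<^sup>j, b)\<close>, where \<open>b\<close> is a nonempty list of positive numbers.\<close>

definition refine :: "nat \<times> nat list \<Rightarrow> (nat \<times> nat) list" where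
  "refine = (\<lambda>(j, b). (j, hd b) # map (Pair 0) (tl b))"

abbreviation refines :: "nat \<times> nat \<Rightarrow> nat \<times> nat list \<Rightarrow> bool" where
  "refines \<equiv> \<lambda>(i, s) (j, b). j \<le> i \<and> composition_of s b"

text \<open>Here \<open>j + length b\<close> and \<open>Suc i\<close> are the lengths of the
  corresponding segments of \<beta> and \<alpha>. Hence the weights multiply to the signed
  coefficient of \<beta>, the sum of the lengths having the parity of their difference.\<close>

definition weight :: "nat \<times> nat \<Rightarrow> nat \<times> nat list \<Rightarrow> 'a" where
  "weight = (\<lambda>(i, s) (j, b). (-1) ^ (j + length b + Suc i) * of_nat (i choose j))"

section \<open>Summation over all refinements\<close>

lemma foldr_refine: "foldr F_block (refine (j, b)) g = strict_sum ((weak_sum ^^ j) (runs b g))"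
  by (simp add: refine_def F_block_def runs_def foldr_map comp_def)

text \<open>The choices of \<open>j\<close> and \<open>b\<close> are independent. For fixed
  \<open>j\<close>, the sum over \<open>b\<close> collapses to D^s behind the linear prefix S W^j;
  the sum over \<open>j\<close> then turns W^j into S^i.\<close>

lemma block_sum:
  assumes "snd p > 0"
  shows "(\<Sum>y | refines p y. weight p y * foldr F_block (refine y) g t) = M_block p g t"
proof -
  obtain i s where p: "p = (i, s)" by force
  let ?C = "{b. composition_of s b}"
  let ?c = "\<lambda>j. (-1) ^ (i + j) * of_nat (i choose j) :: 'a"
  have inner: "(\<Sum>b\<in>?C. (-1) ^ Suc (length b) * strict_sum ((weak_sum ^^ j) (runs b g)) t) =
      strict_sum ((weak_sum ^^ j) ((xmult ^^ s) g)) t" for j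
  proof -
    have "lin (strict_sum \<circ> weak_sum ^^ j)"
      by (intro lin_comp lin_strict_sum lin_funpow lin_weak_sum)
    from lin_sum[OF this, of "\<lambda>b. (-1) ^ Suc (length b)" "\<lambda>b. runs b g" ?C, symmetric]
    show ?thesis
      using assms by (simp only: composition_sum p snd_conv comp_apply)
  qed
  have "{y. refines p y} = {..i} \<times> ?C" by (auto simp: p)
  then have "(\<Sum>y | refines p y. weight p y * foldr F_block (refine y) g t) =
      (\<Sum>j\<le>i. \<Sum>b\<in>?C. weight p (j, b) * foldr F_block (refine (j, b)) g t)"
    by (simp add: sum.cartesian_product)
  \<comment> \<open>The sign exponent splits into \<open>i + j\<close> and
    \<open>Suc (length b)\<close>, one for each of the two sums.\<close>
  also have "\<dots> = (\<Sum>j\<le>i. ?c j *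
      (\<Sum>b\<in>?C. (-1) ^ Suc (length b) * strict_sum ((weak_sum ^^ j) (runs b g)) t))"
    unfolding foldr_refine
    by (intro sum.cong refl) (simp add: weight_def p sum_distrib_left power_add algebra_simps)
  also have "\<dots> = (\<Sum>j\<le>i. ?c j * strict_sum ((weak_sum ^^ j) ((xmult ^^ s) g)) t)"
    unfolding inner ..
  also have "\<dots> = strict_sum (\<lambda>t. \<Sum>j\<le>i. ?c j * (weak_sum ^^ j) ((xmult ^^ s) g) t) t"
    by (rule lin_sum[OF lin_strict_sum, symmetric])
  also have "\<dots> = M_block p g t"
    by (simp only: binomial_weak_sum) (simp add: M_block_def p)
  finally show ?thesis .
qed

text \<open>Refinements of different blocks are chosen independently. By linearity the operator of
  the head comes out of the sum over the tails, which the induction hypothesis evaluates;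
  \<open>block_sum\<close> handles the head.\<close>

lemma blocks_sum:
  assumes "\<forall>p\<in>set ps. snd p > 0"
  shows "(\<Sum>w | list_all2 refines ps w.
      (\<Prod>(p, y)\<leftarrow>zip ps w. weight p y) * foldr F_block (concat (map refine w)) g t) =
    foldr M_block ps g t"
  using assms
proof (induction ps arbitrary: t)
  case Nil
  have "{w. list_all2 refines [] w} = {[]}" by auto
  then show ?case by simp
next
  case (Cons p ps)
  let ?Y = "{y. refines p y}" and ?W = "{w. list_all2 refines ps w}"
  let ?c = "\<lambda>w. \<Prod>(p, y)\<leftarrow>zip ps w. weight p y"
  let ?G = "\<lambda>w. foldr F_block (concat (map refine w)) g"
  have inner: "(\<Sum>w\<in>?W. ?c w * foldr F_block (refine y) (?G w) t) =
      foldr F_block (refine y) (foldr M_block ps g) t" for y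
  proof -
    have "(\<Sum>w\<in>?W. ?c w * foldr F_block (refine y) (?G w) t) =
        foldr F_block (refine y) (\<lambda>t. \<Sum>w\<in>?W. ?c w * ?G w t) t"
      by (rule lin_sum[symmetric]) (intro lin_foldr lin_F_block)
    then show ?thesis
      using Cons.IH Cons.prems by simp
  qed
  have set_eq: "{w. list_all2 refines (p # ps) w} = (\<lambda>(y, w). y # w) ` (?Y \<times> ?W)"
    by (auto simp: list_all2_Cons1 image_iff)
  have inj: "inj_on (\<lambda>(y, w). y # w) (?Y \<times> ?W)"
    by (auto simp: inj_on_def)
  have "(\<Sum>w | list_all2 refines (p # ps) w.
        (\<Prod>(p, y)\<leftarrow>zip (p # ps) w. weight p y) * ?G w t) =
      (\<Sum>(y, w)\<in>?Y \<times> ?W. weight p y * ?c w * foldr F_block (refine y) (?G w) t)"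
    unfolding set_eq sum.reindex[OF inj] by (simp add: case_prod_unfold)
  also have "\<dots> = (\<Sum>y\<in>?Y. weight p y * (\<Sum>w\<in>?W. ?c w * foldr F_block (refine y) (?G w) t))"
    by (simp add: sum_distrib_left mult.assoc flip: sum.cartesian_product)
  also have "\<dots> = (\<Sum>y\<in>?Y. weight p y * foldr F_block (refine y) (foldr M_block ps g) t)"
    unfolding inner ..
  also have "\<dots> = foldr M_block (p # ps) g t"
    using block_sum[of p] Cons.prems by simp
  finally show ?case .
qed

section \<open>Block operators from exponents and flags\<close>

lemma foldr_step_M:
  "foldr (\<lambda>(w, a). step w a) (zip (replicate (length \<gamma>) True) \<gamma>) g = foldr (step True) \<gamma> g"
  by (induction \<gamma>) simp_all

text \<open>The zeros give S^i and the positive entry gives S D^s; \<open>M_block\<close> has the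
  single S in front, as S commutes with its powers.\<close>

lemma foldr_M_blocks:
  "foldr (step True) (concat (map (\<lambda>(i, s). replicate i 0 @ [s]) ps)) g = foldr M_block ps g"
proof -
  have "foldr (step True) (replicate i 0) h = (strict_sum ^^ i) h" for i h
    by (induction i) (simp_all add: step_def)
  then show ?thesis
    by (induction ps) (auto simp: M_block_def step_def funpow_swap1)
qed

text \<open>Only the first entry of a block is reached by a strict step. For the first block this
  step starts from 0.\<close>

definition F_flags :: "(nat \<times> nat) list \<Rightarrow> bool list" where
  "F_flags ps = concat (map (\<lambda>(i, s). True # replicate (i + s - 1) False) ps)"

lemma foldr_step_F:
  assumes "\<forall>p\<in>set ps. snd p > 0"
  shows "foldr (\<lambda>(w, a). step w a)
      (zip (F_flags ps) (concat (map (\<lambda>(i, s). replicate i 0 @ replicate s 1) ps))) g =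
    foldr F_block ps g"
proof -
  let ?step = "\<lambda>(w, a). step w a"
  have zeros: "foldr ?step (zip (replicate i False) (replicate i 0)) h = (weak_sum ^^ i) h" for i h
    by (induction i) (simp_all add: step_def)
  have ones: "foldr ?step (zip (replicate s False) (replicate s 1)) h =
      ((weak_sum \<circ> xmult) ^^ s) h" for s h
    by (induction s) (simp_all add: step_def)
  have block: "foldr ?step (zip (True # replicate (i + s - 1) False)
      (replicate i 0 @ replicate s 1)) h = F_block (i, s) h" if pos: "s > 0" for i s h
  proof (cases i)
    case 0
    obtain r where "s = Suc r" using pos by (cases s) auto
    then show ?thesis using 0 ones[of r] by (simp add: F_block_def run_def step_def)
  next
    case (Suc k)
    obtain r where "s = Suc r" using pos by (cases s) auto
    moreover have "zip (replicate (k + s) False) (replicate k 0 @ replicate s (1::nat)) =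
        zip (replicate k False) (replicate k 0) @ zip (replicate s False) (replicate s 1)"
      by (simp add: replicate_add zip_append)
    \<comment> \<open>With \<open>i = Suc k\<close>, the steps S W^k (W D)^s regroup as S W^(k+1) D
      (W D)^(s-1).\<close>
    ultimately show ?thesis
      using Suc zeros ones[of s]
      by (simp add: F_block_def run_def step_def funpow_swap1[of weak_sum k])
  qed
  show ?thesis
    using assms
  proof (induction ps)
    case (Cons p ps)
    obtain i s where p: "p = (i, s)" "s > 0" using Cons.prems by (cases p) auto
    let ?A = "True # replicate (i + s - 1) False" and ?E = "replicate i 0 @ replicate s (1::nat)"
    have len: "length ?A = length ?E" using p by simp
    have flags: "F_flags (p # ps) = ?A @ F_flags ps" by (simp add: F_flags_def p)
    have exps: "concat (map (\<lambda>(i, s). replicate i 0 @ replicate s 1) (p # ps)) =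
        ?E @ concat (map (\<lambda>(i, s). replicate i 0 @ replicate s 1) ps)"
      by (simp add: p)
    show ?case
      unfolding flags exps zip_append[OF len] foldr_append block[OF p(2)]
      using Cons by (simp add: p)
  qed (simp add: F_flags_def)
qed

lemma weights_eq:
  assumes "list_all2 refines ps w"
  shows "(\<Prod>(p, y)\<leftarrow>zip ps w. weight p y) =
    (-1) ^ (length (concat (map (\<lambda>(j, b). replicate j 0 @ b) w)) +
       length (concat (map (\<lambda>(i, s). replicate i 0 @ [s]) ps))) *
    of_nat (\<Prod>((i, s), (j, b))\<leftarrow>zip ps w. i choose j)"
  using assms
  by (induction ps w rule: list_all2_induct)
    (auto simp: weight_def power_add algebra_simps)

end

section \<open>Blocks of refinements and index sets as flagged sequences\<close>

text \<open>Zeros occur only before the first part of each \<open>b\<close>, so every later part is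
  a block of its own without zeros.\<close>

lemma blocks_concat_refine:
  assumes "\<forall>(j, b)\<in>set w. b \<noteq> [] \<and> (\<forall>x\<in>set b. x > 0)"
  shows "blocks (concat (map (\<lambda>(j, b). replicate j 0 @ b) w)) = concat (map refine w)"
proof -
  have pos: "blocks_from 0 (b @ r) = map (Pair 0) b @ blocks_from 0 r"
    if "\<forall>x\<in>set b. x > 0" for b r
    using that by (induction b) auto
  have "blocks_from 0 (replicate j 0 @ b @ r) = refine (j, b) @ blocks_from 0 r"
    if "b \<noteq> []" "\<forall>x\<in>set b. x > 0" for j b r
    using that pos by (cases b) (auto simp: blocks_from_replicate refine_def)
  then show ?thesis
    using assms by (induction w) (auto simp: blocks_def)
qed

text \<open>Prepending 0 encodes positivity as one more strict step.\<close>

lemma M_indices_iff: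
  "ns \<in> M_indices \<gamma> \<longleftrightarrow> length ns = length \<gamma> \<and> (\<forall>j<length ns. (0 # ns) ! j < ns ! j)"
proof -
  have "(\<forall>j<length ns. (0 # ns) ! j < ns ! j) \<longleftrightarrow> sorted_wrt (<) (0 # ns)"
    by (simp add: sorted_wrt_iff_nth_Suc_transp del: sorted_wrt.simps)
  then show ?thesis by (auto simp: M_indices_def Suc_le_eq)
qed

text \<open>The partial sums of the block lengths are the starting positions counted from 0;
  removing the first block shifts them by \<open>i + s\<close>.\<close>

lemma nth_F_flags:
  assumes "\<forall>p\<in>set ps. snd p > 0" "j < (\<Sum>(i, s)\<leftarrow>ps. i + s)"
  shows "F_flags ps ! j \<longleftrightarrow> j \<in> (\<lambda>p. \<Sum>(i, s)\<leftarrow>take p ps. i + s) ` {..<length ps}"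
  using assms
proof (induction ps arbitrary: j)
  case Nil
  then show ?case by simp
next
  case (Cons q ps)
  obtain i s where q: "q = (i, s)" "s > 0" using Cons.prems by (cases q) auto
  let ?pos = "\<lambda>ps p. \<Sum>(i, s)\<leftarrow>take p ps. i + s"
  have image: "?pos (q # ps) ` {..<length (q # ps)} =
      insert 0 ((+) (i + s) ` ?pos ps ` {..<length ps})"
    by (simp add: lessThan_Suc_eq_insert_0 image_image q)
  have flags: "F_flags (q # ps) = (True # replicate (i + s - 1) False) @ F_flags ps"
    by (simp add: F_flags_def q)
  show ?case
  proof (cases "j < i + s")
    case True
    then have "F_flags (q # ps) ! j \<longleftrightarrow> j = 0"
      unfolding flags by (cases j) (auto simp: nth_append)
    then show ?thesis using True unfolding image by auto
  next
    case False
    then have "F_flags (q # ps) ! j \<longleftrightarrow> F_flags ps ! (j - (i + s))"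
      unfolding flags using q by (simp add: nth_append del: append_Cons)
    also have "\<dots> \<longleftrightarrow> j - (i + s) \<in> ?pos ps ` {..<length ps}"
      using Cons.prems False by (intro Cons.IH) (auto simp: q)
    also have "\<dots> \<longleftrightarrow> j \<in> ?pos (q # ps) ` {..<length (q # ps)}"
    proof -
      have "j = i + s + (j - (i + s))" "j \<noteq> 0" using False q by auto
      then show ?thesis unfolding image by (metis (no_types, lifting) add_left_imp_eq image_iff insert_iff)
    qed
    finally show ?thesis .
  qed
qed

lemma length_F_flags:
  "\<forall>p\<in>set ps. snd p > 0 \<Longrightarrow> length (F_flags ps) = (\<Sum>(i, s)\<leftarrow>ps. i + s)"
  by (induction ps) (auto simp: F_flags_def)

lemma blocks_pos: "\<forall>p\<in>set (blocks \<alpha>). snd p > 0"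
  using blocks_from_pos by (fastforce simp: blocks_def)

text \<open>Counted from 0, the positions \<open>a_pos \<beta> p\<close> with
  \<open>p \<ge> 1\<close> are the starts of the blocks after the first. The additional flag at
  position 0 compares the first index with 0 and takes over the positivity condition.\<close>

lemma F_indices_iff:
  assumes "left_weak_comp \<beta>"
  shows "ns \<in> F_indices \<beta> \<longleftrightarrow> length ns = length (F_flags (blocks \<beta>)) \<and>
    (\<forall>j<length ns. if F_flags (blocks \<beta>) ! j then (0 # ns) ! j < ns ! j
       else (0 # ns) ! j \<le> ns ! j)" (is "_ \<longleftrightarrow> ?len \<and> (\<forall>j<length ns. ?ok j)")
proof (cases ?len)
  case False
  then show ?thesis
    by (auto simp: F_indices_def a_pos_def length_F_flags[OF blocks_pos])
next
  case len: True
  have size: "length ns = (\<Sum>(i, s)\<leftarrow>blocks \<beta>. i + s)"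
    using len by (simp add: length_F_flags[OF blocks_pos])
  have flag: "F_flags (blocks \<beta>) ! j \<longleftrightarrow> j \<in> a_pos \<beta> ` {..<length (blocks \<beta>)}"
    if "j < length ns" for j
    using nth_F_flags[OF blocks_pos] that size by (simp add: a_pos_def)
  have split: "{..<length (blocks \<beta>)} = insert 0 {1..<length (blocks \<beta>)}"
    using blocks_nonempty[OF assms] by auto
  have flag_Suc: "F_flags (blocks \<beta>) ! j \<longleftrightarrow> j \<in> a_pos \<beta> ` {1..<length (blocks \<beta>)}"
    if "1 \<le> j" "j < length ns" for j
    using flag[OF that(2)] that(1) unfolding split by (simp add: a_pos_def)
  have flag_0: "F_flags (blocks \<beta>) ! 0" if "ns \<noteq> []"
    using flag[of 0] that unfolding split by (simp add: a_pos_def)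
  have steps: "(\<forall>j. 1 \<le> j \<and> j < length ns \<longrightarrow>
      (if j \<in> a_pos \<beta> ` {1..<length (blocks \<beta>)} then ns ! (j - 1) < ns ! j
       else ns ! (j - 1) \<le> ns ! j)) \<longleftrightarrow> (\<forall>j. 1 \<le> j \<and> j < length ns \<longrightarrow> ?ok j)" (is "_ \<longleftrightarrow> ?B")
    using flag_Suc by (simp add: nth_Cons')
  have F: "ns \<in> F_indices \<beta> \<longleftrightarrow> (\<forall>n\<in>set ns. 1 \<le> n) \<and> ?B"
    unfolding F_indices_def mem_Collect_eq steps using size by (simp add: a_pos_def)
  show ?thesis
  proof (cases "ns = []")
    case True
    then show ?thesis using F len by simp
  next
    case False
    have "(\<forall>j<l. P j) \<longleftrightarrow> P 0 \<and> (\<forall>j. 1 \<le> j \<and> j < l \<longrightarrow> P j)" if "0 < l" for P and l :: nat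
      using that by (metis One_nat_def Suc_leI neq0_conv)
    from this[of "length ns" ?ok] have "(\<forall>j<length ns. ?ok j) \<longleftrightarrow> ?ok 0 \<and> ?B"
      using False by simp
    then have "(\<forall>j<length ns. ?ok j) \<longleftrightarrow> 1 \<le> ns ! 0 \<and> ?B"
      using flag_0[OF False] by (simp add: Suc_le_eq)
    \<comment> \<open>All steps are at least weakly increasing, so positivity of the first index
      passes to the others.\<close>
    moreover have "\<forall>n\<in>set ns. 1 \<le> n" if "1 \<le> ns ! 0" ?B
    proof -
      have "ns ! i \<le> ns ! Suc i" if "Suc i < length ns" for i
        using \<open>?B\<close>[rule_format, of "Suc i"] that by (simp split: if_splits)
      then have "sorted ns" by (simp add: sorted_iff_nth_Suc)
      then have "ns ! 0 \<le> n" if "n \<in> set ns" for n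
        using that by (metis in_set_conv_nth le0 sorted_nth_mono)
      then show ?thesis using \<open>1 \<le> ns ! 0\<close> by fastforce
    qed
    moreover have "1 \<le> ns ! 0" if "\<forall>n\<in>set ns. 1 \<le> n"
      using that False by simp
    ultimately show ?thesis using F len by blast
  qed
qed

section \<open>Coefficients from truncated polynomials\<close>

text \<open>The last index is the largest, and its positive exponent cannot cancel, so it occurs in
  the monomial.\<close>

lemma le_of_keys_mono_of:
  assumes "e \<noteq> []" "last e > 0" "length ns = length e" "sorted ns"
    and keys: "Poly_Mapping.keys (mono_of ns e) \<subseteq> {..B}"
  shows "\<forall>n\<in>set ns. n \<le> B"
proof -
  obtain e' a where e: "e = e' @ [a]" "a > 0" using assms(1,2) by (cases e rule: rev_cases) auto
  obtain ns' n where ns: "ns = ns' @ [n]" "length ns' = length e'"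
    using assms(3) e by (cases ns rule: rev_cases) auto
  have "Poly_Mapping.lookup (mono_of ns e) n > 0"
    using e by (simp add: mono_of_def ns lookup_add)
  then have "n \<in> Poly_Mapping.keys (mono_of ns e)" by (simp add: in_keys_iff)
  then have "n \<le> B" using keys by auto
  then show ?thesis using assms(4) by (auto simp: ns sorted_append)
qed

text \<open>The variable x_n in the polynomial ring over the rationals, the ring in which the
  operators are evaluated.\<close>

definition var :: "nat \<Rightarrow> monomial \<Rightarrow>\<^sub>0 rat" where
  "var n = Poly_Mapping.single (Poly_Mapping.single n 1) 1"

lemma var_power: "var n ^ a = Poly_Mapping.single (Poly_Mapping.single n a) 1"
proof (induction a)
  case (Suc a)
  then show ?case by (simp add: var_def mult_single flip: single_add)
qed simp

lemma eval_mono_var: "eval_mono var ns e = Poly_Mapping.single (mono_of ns e) 1"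
proof -
  have "(\<Prod>(n, a)\<leftarrow>l. var n ^ a) =
      Poly_Mapping.single (\<Sum>(n, a)\<leftarrow>l. Poly_Mapping.single n a) 1" for l
    by (induction l) (auto simp: var_power mult_single)
  then show ?thesis by (simp add: eval_mono_def mono_of_def)
qed

text \<open>Every index sequence producing \<open>m\<close> is bounded by \<open>B\<close>, hence is
  a chain. Each chain contributes one monomial with coefficient 1, so the lookup counts the same
  sequences.\<close>

lemma series_of_eq_lookup:
  assumes bound: "Poly_Mapping.keys m \<subseteq> {..B}" and e: "e \<noteq> []" "last e > 0"
    and len: "length ws = length e"
    and N: "\<And>ns. ns \<in> N \<longleftrightarrow> length ns = length ws \<and>
      (\<forall>j<length ns. if ws ! j then (0 # ns) ! j < ns ! j else (0 # ns) ! j \<le> ns ! j)"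
  shows "series_of N e m = Poly_Mapping.lookup
    (foldr (\<lambda>(w, a). step B var w a) (zip ws e) (\<lambda>_. 1) 0) m"
proof -
  have "sorted ns \<and> length ns = length e" if "ns \<in> N" for ns
  proof -
    have "ns ! i \<le> ns ! Suc i" if "Suc i < length ns" for i
    proof -
      have "if ws ! Suc i then (0 # ns) ! Suc i < ns ! Suc i else (0 # ns) ! Suc i \<le> ns ! Suc i"
        using \<open>ns \<in> N\<close> that unfolding N by blast
      then show ?thesis by (simp split: if_splits)
    qed
    then show ?thesis using \<open>ns \<in> N\<close> len by (simp add: N sorted_iff_nth_Suc)
  qed
  then have "\<forall>n\<in>set ns. n \<le> B" if "ns \<in> N" "mono_of ns e = m" for ns
    using le_of_keys_mono_of[OF e] that bound by blast
  then have "ns \<in> N \<and> mono_of ns e = m \<longleftrightarrow> ns \<in> chains B 0 ws \<and> mono_of ns e = m" for ns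
    unfolding in_chains_iff N by blast
  then have "{ns \<in> N. mono_of ns e = m} = {ns \<in> chains B 0 ws. mono_of ns e = m}"
    by blast
  then have "series_of N e m = (\<Sum>ns\<in>chains B 0 ws. if mono_of ns e = m then 1 else 0)"
    by (simp add: series_of_def finite_chains flip: sum.inter_filter)
  also have "\<dots> = Poly_Mapping.lookup (\<Sum>ns\<in>chains B 0 ws. eval_mono var ns e) m"
    by (simp add: lookup_sum eval_mono_var lookup_single when_def)
  finally show ?thesis by (simp add: sum_chains len)
qed

lemma M_series_eq_lookup:
  assumes "left_weak_comp \<alpha>" "Poly_Mapping.keys m \<subseteq> {..B}"
  shows "M_series \<alpha> m =
    Poly_Mapping.lookup (foldr (M_block B var) (blocks \<alpha>) (\<lambda>_. 1) 0) m"
proof -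
  have "concat (map (\<lambda>(i, s). replicate i 0 @ [s]) (blocks \<alpha>)) = \<alpha>"
    using blocks_iff[OF assms(1)] by metis
  moreover have "M_series \<alpha> m = Poly_Mapping.lookup (foldr (\<lambda>(w, a). step B var w a)
      (zip (replicate (length \<alpha>) True) \<alpha>) (\<lambda>_. 1) 0) m"
    unfolding M_series_def
    using assms by (intro series_of_eq_lookup) (auto simp: M_indices_iff left_weak_comp_def)
  ultimately show ?thesis
    using foldr_M_blocks[of B var "blocks \<alpha>"] by (simp add: foldr_step_M)
qed

lemma F_series_eq_lookup:
  assumes "left_weak_comp \<beta>" "Poly_Mapping.keys m \<subseteq> {..B}"
  shows "F_series \<beta> m =
    Poly_Mapping.lookup (foldr (F_block B var) (blocks \<beta>) (\<lambda>_. 1) 0) m"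
proof -
  have "F_exponents \<beta> \<noteq> [] \<and> last (F_exponents \<beta>) > 0"
    unfolding F_exponents_def using blocks_nonempty[OF assms(1)]
    by (rule concat_last_pos) (use blocks_pos[of \<beta>] in auto)
  moreover have "length (F_flags (blocks \<beta>)) = length (F_exponents \<beta>)"
    by (simp add: length_F_exponents a_pos_def length_F_flags[OF blocks_pos])
  ultimately have "F_series \<beta> m = Poly_Mapping.lookup (foldr (\<lambda>(w, a). step B var w a)
      (zip (F_flags (blocks \<beta>)) (F_exponents \<beta>)) (\<lambda>_. 1) 0) m"
    unfolding F_series_def
    using assms F_indices_iff by (intro series_of_eq_lookup) auto
  then show ?thesis
    unfolding F_exponents_def foldr_step_F[OF blocks_pos] .
qed

section \<open>Signs and the expansion of M\<close>

text \<open>The weights lie in the polynomial ring, but as integer constants they come out of the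
  coefficient extraction as rationals.\<close>

lemma lookup_sign_of_nat_mult:
  "Poly_Mapping.lookup ((-1) ^ k * of_nat c * p) m =
    (-1) ^ k * of_nat c * Poly_Mapping.lookup (p :: monomial \<Rightarrow>\<^sub>0 rat) m"
proof -
  have "Poly_Mapping.lookup (of_nat c * p) m = of_nat c * Poly_Mapping.lookup p m"
    by (induction c) (simp_all add: algebra_simps lookup_add)
  then show ?thesis by (cases "even k") (simp_all add: mult.assoc)
qed

lemma powi_diff_sign: "(-1 :: rat) powi (int a - int b) = (-1) ^ (a + b)"
  by (cases "even b") (simp_all add: power_int_diff power_add)

theorem theorem4p4:
  fixes \<alpha> :: "nat list"
  assumes "left_weak_comp \<alpha>"
  shows "M_series \<alpha> = (\<lambda>m. \<Sum>\<beta> | \<beta> \<preceq> \<alpha>.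
           (-1) powi (int (length \<beta>) - int (length \<alpha>)) * of_nat (c_coeff \<alpha> \<beta>) * F_series \<beta> m)"
proof
  fix m :: monomial
  \<comment> \<open>The inserted 0 keeps the maximum defined for the monomial 1, which has no
    keys.\<close>
  define B where "B = Max (insert 0 (Poly_Mapping.keys m))"
  have bound: "Poly_Mapping.keys m \<subseteq> {..B}" by (auto simp: B_def)
  let ?W = "{w. list_all2 refines (blocks \<alpha>) w}"
  let ?cat = "\<lambda>w. concat (map (\<lambda>(j, b). replicate j 0 @ b) w) :: nat list"
  let ?term = "\<lambda>\<beta>. (-1) powi (int (length \<beta>) - int (length \<alpha>)) * of_nat (c_coeff \<alpha> \<beta>) *
    F_series \<beta> m"
  have decomp: "decomp \<alpha> w (?cat w)" if "w \<in> ?W" for w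
    using that by (simp add: decomp_def)
  have \<alpha>: "concat (map (\<lambda>(i, s). replicate i 0 @ [s]) (blocks \<alpha>)) = \<alpha>"
    using blocks_iff[OF assms] by metis
  have term_eq: "?term (?cat w) = Poly_Mapping.lookup ((\<Prod>(p, y)\<leftarrow>zip (blocks \<alpha>) w. weight p y) *
      foldr (F_block B var) (concat (map refine w)) (\<lambda>_. 1) 0) m" if w: "w \<in> ?W" for w
  proof -
    have "\<forall>(j, b)\<in>set w. b \<noteq> [] \<and> (\<forall>x\<in>set b. x > 0)"
      using w by (fastforce simp: list_all2_conv_all_nth in_set_conv_nth composition_of_def)
    then have "blocks (?cat w) = concat (map refine w)" by (rule blocks_concat_refine)
    moreover have "left_weak_comp (?cat w)"
      using preceq_left_weak_comp[OF assms] decomp[OF w] by (auto simp: preceq_def)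
    ultimately have "F_series (?cat w) m =
        Poly_Mapping.lookup (foldr (F_block B var) (concat (map refine w)) (\<lambda>_. 1) 0) m"
      using F_series_eq_lookup[OF _ bound] by metis
    moreover have "list_all2 refines (blocks \<alpha>) w" using w by simp
    ultimately show ?thesis
      by (simp only: weights_eq \<alpha> lookup_sign_of_nat_mult powi_diff_sign c_coeff_eq[OF decomp[OF w]])
  qed
  have "{\<beta>. \<beta> \<preceq> \<alpha>} = ?cat ` ?W"
    by (auto simp: preceq_def decomp_def)
  \<comment> \<open>Uniqueness of decompositions allows summation over the decompositions
    \<open>w\<close> instead of over \<beta>.\<close>
  moreover have "inj_on ?cat ?W"
    by (rule inj_onI) (metis decomp decomp_unique)
  ultimately have "(\<Sum>\<beta> | \<beta> \<preceq> \<alpha>. ?term \<beta>) = (\<Sum>w\<in>?W. ?term (?cat w))"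
    by (simp add: sum.reindex)
  also have "\<dots> = Poly_Mapping.lookup (\<Sum>w\<in>?W. (\<Prod>(p, y)\<leftarrow>zip (blocks \<alpha>) w. weight p y) *
      foldr (F_block B var) (concat (map refine w)) (\<lambda>_. 1) 0) m"
    by (simp add: term_eq lookup_sum)
  also have "\<dots> = M_series \<alpha> m"
    by (simp only: blocks_sum[OF blocks_pos] M_series_eq_lookup[OF assms bound])
  finally show "M_series \<alpha> m = (\<Sum>\<beta> | \<beta> \<preceq> \<alpha>. ?term \<beta>)" ..
qed

end
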